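(* Let $\mathbb F$ be a field and $n$ a positive integer such that either $n=2$ and $|\mathbb F|>3$, or $n>2$. Let $G=\operatorname{GL}(n,\mathbb F)$ and $S=\operatorname{SL}(n,\mathbb F)$. (1) $P(G)=Z(G)\cdot S$, that is, the set of all matrices in $G$ whose determinant is an $n$-th power in $\mathbb F$. (2) $P(S)=S$. (3) $P(S/Z(S))=S/Z(S)$. (4) $P(G/Z(G))=SZ(G)/Z(G)$. (5) $P(P(G))=P(G)$.
   Context: For a group $G$, the pseudocentre is $P(G)=\bigcap_{x\in G}C_G(x)^G$, where $C_G(x)$ is the centralizer of $x$ in $G$ and, for a subgroup $H\leq G$, $H^G$ is the normal closure of $H$ in $G$. $Z(G)$ denotes the centre of $G$. *)

theory Defs
  imports "HOL-Algebra.Coset" "Jordan_Normal_Form.Determinant"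
begin

definition centre :: "('g, 'b) monoid_scheme \<Rightarrow> 'g set" where
  "centre G = {z \<in> carrier G. \<forall>g \<in> carrier G. z \<otimes>\<^bsub>G\<^esub> g = g \<otimes>\<^bsub>G\<^esub> z}"

definition centralizer :: "('g, 'b) monoid_scheme \<Rightarrow> 'g \<Rightarrow> 'g set" where
  "centralizer G x = {g \<in> carrier G. g \<otimes>\<^bsub>G\<^esub> x = x \<otimes>\<^bsub>G\<^esub> g}"

definition normal_closure :: "('g, 'b) monoid_scheme \<Rightarrow> 'g set \<Rightarrow> 'g set" where
  "normal_closure G H = \<Inter> {N. N \<lhd> G \<and> H \<subseteq> N}"

definition pseudocentre :: "('g, 'b) monoid_scheme \<Rightarrow> 'g set" where
  "pseudocentre G = (\<Inter>x \<in> carrier G. normal_closure G (centralizer G x))"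

text \<open>The pseudocentre is a subgroup, so it can be regarded as a group in its own right,
  namely \<open>G\<lparr>carrier := pseudocentre G\<rparr>\<close>; the same goes for \<open>SL\<close> inside \<open>GL\<close> below.\<close>

definition GL :: "nat \<Rightarrow> 'a::field mat monoid" where
  "GL n = units_of (ring_mat TYPE('a) n ())"

definition SL :: "nat \<Rightarrow> 'a::field mat monoid" where
  "SL n = (GL n)\<lparr>carrier := {A \<in> carrier (GL n). det A = 1}\<rparr>"

lemma centre_memD:
  assumes "z \<in> centre G"
  shows "z \<in> carrier G" and "g \<in> carrier G \<Longrightarrow> z \<otimes>\<^bsub>G\<^esub> g = g \<otimes>\<^bsub>G\<^esub> z"
  using assms unfolding centre_def by blast+

lemma centre_memI:
  assumes "z \<in> carrier G" and "\<And>g. g \<in> carrier G \<Longrightarrow> z \<otimes>\<^bsub>G\<^esub> g = g \<otimes>\<^bsub>G\<^esub> z"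
  shows "z \<in> centre G"
  using assms unfolding centre_def by blast

lemma (in group) centre_normal: "centre G \<lhd> G"
proof (rule normal_invI)
  show "subgroup (centre G) G"
  proof (rule subgroupI)
    show "centre G \<subseteq> carrier G"
      by (rule subsetI) (rule centre_memD(1))
    have "\<one> \<in> centre G"
      by (rule centre_memI) simp_all
    then show "centre G \<noteq> {}" by blast
  next
    fix a assume "a \<in> centre G"
    note a = centre_memD[OF this]
    show "inv a \<in> centre G"
    proof (rule centre_memI)
      fix g assume g: "g \<in> carrier G"
      have "inv a \<otimes> g = inv (inv g \<otimes> a)"
        using a(1) g by (simp add: inv_mult_group)
      also have "\<dots> = inv (a \<otimes> inv g)"
        by (subst a(2)) (use g in simp_all)
      also have "\<dots> = g \<otimes> inv a"
        using a(1) g by (simp add: inv_mult_group)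
      finally show "inv a \<otimes> g = g \<otimes> inv a" .
    qed (use a(1) in simp)
  next
    fix a b assume "a \<in> centre G" "b \<in> centre G"
    note a = centre_memD[OF this(1)] and b = centre_memD[OF this(2)]
    show "a \<otimes> b \<in> centre G"
    proof (rule centre_memI)
      fix g assume g: "g \<in> carrier G"
      have "a \<otimes> b \<otimes> g = a \<otimes> (b \<otimes> g)"
        using a(1) b(1) g by (simp add: m_assoc)
      also have "\<dots> = a \<otimes> g \<otimes> b"
        using a(1) b(1) g by (simp only: b(2)[OF g] m_assoc)
      also have "\<dots> = g \<otimes> (a \<otimes> b)"
        using a(1) b(1) g by (simp only: a(2)[OF g] m_assoc)
      finally show "a \<otimes> b \<otimes> g = g \<otimes> (a \<otimes> b)" .
    qed (use a(1) b(1) in simp)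
  qed
next
  fix x h assume x: "x \<in> carrier G" and h: "h \<in> centre G"
  note h' = centre_memD[OF h]
  have "x \<otimes> h \<otimes> inv x = h \<otimes> x \<otimes> inv x"
    by (simp only: h'(2)[OF x])
  also have "\<dots> = h"
    using x h'(1) by (simp add: m_assoc)
  finally show "x \<otimes> h \<otimes> inv x \<in> centre G" using h by simp
qed

lemma (in group) carrier_normal: "carrier G \<lhd> G"
  by (rule normal_invI) (auto intro: subgroup_self)

lemma (in group) normal_closure_normal:
  assumes "H \<subseteq> carrier G"
  shows "normal_closure G H \<lhd> G"
proof (rule normal_invI)
  have "{N. N \<lhd> G \<and> H \<subseteq> N} \<noteq> {}"
    using carrier_normal assms by blast
  then show "subgroup (normal_closure G H) G"
    unfolding normal_closure_def
    by (intro subgroups_Inter) (auto intro: normal_imp_subgroup)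
next
  fix x h assume "x \<in> carrier G" "h \<in> normal_closure G H"
  then show "x \<otimes> h \<otimes> inv x \<in> normal_closure G H"
    unfolding normal_closure_def by (auto intro: normal.inv_op_closed2)
qed

lemma (in group) pseudocentre_normal: "pseudocentre G \<lhd> G"
proof (rule normal_invI)
  have N: "normal_closure G (centralizer G x) \<lhd> G" for x
    by (rule normal_closure_normal) (auto simp: centralizer_def)
  have "carrier G \<noteq> {}" by auto
  then show "subgroup (pseudocentre G) G"
    unfolding pseudocentre_def
    by (intro subgroups_Inter) (auto intro: normal_imp_subgroup N)
  fix x h assume "x \<in> carrier G" "h \<in> pseudocentre G"
  then show "x \<otimes> h \<otimes> inv x \<in> pseudocentre G"
    unfolding pseudocentre_def by (auto intro: normal.inv_op_closed2[OF N])
qed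

lemma group_GL: "group (GL n)"
  unfolding GL_def
  by (intro monoid.units_group semiring.axioms semiring.axioms(2) semiring_mat)

lemma mult_GL: "A \<otimes>\<^bsub>GL n\<^esub> B = A * B"
  by (simp add: GL_def units_of_def ring_mat_def)

lemma one_GL: "\<one>\<^bsub>GL n\<^esub> = 1\<^sub>m n"
  by (simp add: GL_def units_of_def ring_mat_def)

lemma carrier_GL: "carrier (GL n) = {A :: 'a::field mat. A \<in> carrier_mat n n \<and> det A \<noteq> 0}"
proof -
  have "A \<in> carrier_mat n n" if "A \<in> Units (ring_mat TYPE('a) n ())" for A :: "'a mat"
    using that by (simp add: Units_def ring_mat_def)
  then show ?thesis
    unfolding GL_def units_of_carrier
    by (auto intro: det_non_zero_imp_unit dest: unit_imp_det_non_zero)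
qed

lemma subgroup_SL: "subgroup (carrier (SL n)) (GL n)"
proof -
  interpret group "GL n :: 'a mat monoid" by (rule group_GL)
  show ?thesis
  proof (rule subgroupI)
    fix A :: "'a mat" assume A: "A \<in> carrier (SL n)"
    then have A': "A \<in> carrier (GL n)" by (simp add: SL_def)
    let ?B = "inv\<^bsub>GL n\<^esub> A"
    have B: "?B \<in> carrier (GL n)" using A' by simp
    have "?B * A = 1\<^sub>m n" using l_inv[OF A'] by (simp add: mult_GL one_GL)
    then have "det ?B * det A = 1"
      using A' B det_mult[of ?B n A] by (simp add: carrier_GL)
    with A B show "?B \<in> carrier (SL n)" by (simp add: SL_def)
  next
    fix A B :: "'a mat" assume "A \<in> carrier (SL n)" "B \<in> carrier (SL n)"
    then show "A \<otimes>\<^bsub>GL n\<^esub> B \<in> carrier (SL n)"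
      by (auto simp: SL_def mult_GL carrier_GL det_mult[of A n B])
  next
    have "1\<^sub>m n \<in> carrier (SL n :: 'a mat monoid)"
      by (simp add: SL_def carrier_GL)
    then show "carrier (SL n :: 'a mat monoid) \<noteq> {}" by blast
  qed (auto simp: SL_def)
qed

lemma group_SL: "group (SL n)"
  using group.subgroup_imp_group[OF group_GL subgroup_SL[of n]] by (simp add: SL_def)

end

theory Submission
  imports Defs
begin

text \<open>Since \<open>x\<close> lies in its own centralizer, everything rests on one fact: a subgroup \<open>N\<close> of
  \<open>GL\<close> that is normalized by \<open>SL\<close> and contains a non-central \<open>x\<close> contains \<open>SL\<close>. This is proved in
  the manner of Iwasawa. Let \<open>A\<close> be the abelian group of matrices \<open>1 + e\<^sub>k f\<^sup>T\<close> with \<open>f\<^sub>k = 0\<close>. If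
  \<open>x e\<^sub>k\<close> is not a multiple of \<open>e\<^sub>k\<close>, then conjugating \<open>x\<close> by elements of \<open>SL\<close> that fix \<open>e\<^sub>k\<close> yields,
  for each \<open>i \<noteq> k\<close>, an element \<open>m\<close> of \<open>N\<close> mapping the line of \<open>e\<^sub>k\<close> to that of \<open>e\<^sub>i\<close>; hence each
  elementary matrix is \<open>m b m\<^bsup>-1\<^esup> \<in> N A\<close> with \<open>b \<in> A\<close>, and \<open>SL \<le> N A\<close>. As \<open>A\<close> is abelian,
  commutators of elements of \<open>SL\<close> lie in \<open>N\<close>, and elementary matrices are such commutators.

  For the upper bounds, let \<open>J\<close> be a single unipotent Jordan block. If \<open>g J = c J g\<close> with \<open>g\<close>
  invertible, then \<open>c = 1\<close> and \<open>g\<close> is a polynomial in \<open>J\<close>, so \<open>det g\<close> is an \<open>n\<close>-th power.\<close>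

subsection \<open>Elementary matrices generate the special linear group\<close>

definition delta :: "nat \<Rightarrow> nat \<Rightarrow> 'a::field" where
  "delta k i = (if i = k then 1 else 0)"

text \<open>The matrix \<open>1 + u f\<^sup>T\<close>, a transvection only when \<open>f\<^sup>T u = 0\<close>. The elementary matrix with
  entry \<open>a\<close> at \<open>(i, j)\<close> is written \<open>transvec n (delta i) (\<lambda>q. a * delta j q)\<close>.\<close>

definition transvec :: "nat \<Rightarrow> (nat \<Rightarrow> 'a::field) \<Rightarrow> (nat \<Rightarrow> 'a) \<Rightarrow> 'a mat" where
  "transvec n u f = mat n n (\<lambda>(i, j). delta i j + u i * f j)"

lemma delta_simps [simp]: "delta k k = 1" "i \<noteq> k \<Longrightarrow> delta k i = 0"
  by (simp_all add: delta_def)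

lemma sum_delta [simp]:
  assumes "k < n"
  shows "(\<Sum>i = 0..<n. delta k i * g i) = g k" "(\<Sum>i = 0..<n. delta i k * g i) = g k"
    "(\<Sum>i = 0..<n. g i * delta k i) = g k" "(\<Sum>i = 0..<n. g i * delta i k) = g k"
  using assms by (simp_all add: delta_def if_distrib if_distribR cong: if_cong)

lemma transvec_carrier [simp]:
  "transvec n u f \<in> carrier_mat n n" "dim_row (transvec n u f) = n" "dim_col (transvec n u f) = n"
  by (simp_all add: transvec_def)

lemma transvec_index [simp]:
  "p < n \<Longrightarrow> q < n \<Longrightarrow> transvec n u f $$ (p, q) = delta p q + u p * f q"
  by (simp add: transvec_def)

text \<open>Entrywise proofs below delete \<open>index_mult_mat(1)\<close>, so that this formula and
  its mirror image rewrite products with a \<open>transvec\<close> before they unfold into scalar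
  products.\<close>

lemma transvec_mult_index:
  assumes "X \<in> carrier_mat n n" "p < n" "q < n"
  shows "(transvec n u f * X) $$ (p, q) = X $$ (p, q) + u p * (\<Sum>r = 0..<n. f r * X $$ (r, q))"
proof -
  have "(transvec n u f * X) $$ (p, q) = (\<Sum>r = 0..<n. delta p r * X $$ (r, q) + u p * (f r * X $$ (r, q)))"
    using assms by (simp add: scalar_prod_def algebra_simps)
  then show ?thesis
    using assms by (simp add: sum.distrib sum_distrib_left)
qed

lemma mult_transvec_index:
  assumes "X \<in> carrier_mat n n" "p < n" "q < n"
  shows "(X * transvec n u f) $$ (p, q) = X $$ (p, q) + (\<Sum>r = 0..<n. X $$ (p, r) * u r) * f q"
proof -
  have "(X * transvec n u f) $$ (p, q) = (\<Sum>r = 0..<n. X $$ (p, r) * delta r q + (X $$ (p, r) * u r) * f q)"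
    using assms by (simp add: scalar_prod_def algebra_simps)
  then show ?thesis
    using assms by (simp add: sum.distrib sum_distrib_right)
qed

text \<open>Each cross term contains the scalar \<open>f\<^sup>T v\<close>, which is zero.\<close>

lemma transvec_mult:
  assumes "(\<Sum>r = 0..<n. f r * v r) = 0"
  shows "transvec n u f * transvec n v f = transvec n (\<lambda>i. u i + v i) f"
    and "transvec n v f * transvec n v g = transvec n v (\<lambda>i. f i + g i)"
proof -
  have *: "(\<Sum>r = 0..<n. f r * (delta r q + v r * h q)) = f q" if "q < n" for q h
  proof -
    have "(\<Sum>r = 0..<n. f r * (delta r q + v r * h q)) = f q + (\<Sum>r = 0..<n. f r * v r) * h q"
      using that by (simp add: distrib_left sum.distrib sum_distrib_right mult.assoc)
    then show ?thesis by (simp add: assms)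
  qed
  show "transvec n u f * transvec n v f = transvec n (\<lambda>i. u i + v i) f"
    by (rule eq_matI) (simp_all add: transvec_mult_index * del: index_mult_mat(1), simp add: algebra_simps)
  show "transvec n v f * transvec n v g = transvec n v (\<lambda>i. f i + g i)"
    by (rule eq_matI) (simp_all add: transvec_mult_index * del: index_mult_mat(1), simp add: algebra_simps)
qed

lemma transvec_zero: "transvec n (\<lambda>_. 0) f = 1\<^sub>m n" "transvec n u (\<lambda>_. 0) = 1\<^sub>m n"
  by (rule eq_matI; simp add: delta_def)+

lemma transvec_minus:
  assumes "(\<Sum>r = 0..<n. f r * u r) = 0"
  shows "transvec n u f * transvec n (\<lambda>i. - u i) f = 1\<^sub>m n"
  using assms by (subst transvec_mult) (simp_all add: sum_negf transvec_zero)

text \<open>Only the identity survives in the Leibniz formula: any other permutation moves some row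
  index besides \<open>k\<close>, and the entry there is 0.\<close>

lemma det_rows_delta:
  assumes A: "A \<in> carrier_mat n n" and k: "k < n"
    and rows: "\<And>i j. i < n \<Longrightarrow> j < n \<Longrightarrow> i \<noteq> k \<Longrightarrow> A $$ (i, j) = delta i j"
  shows "det A = A $$ (k, k)"
proof -
  let ?t = "\<lambda>p. signof p * (\<Prod>i = 0..<n. A $$ (i, p i))"
  have "?t p = 0" if p: "p permutes {0..<n}" and "p \<noteq> id" for p
  proof -
    \<comment> \<open>By injectivity, a permutation cannot move \<open>k\<close> alone.\<close>
    have "\<exists>i \<in> {0..<n}. i \<noteq> k \<and> p i \<noteq> i"
    proof (rule ccontr)
      assume c: "\<not> ?thesis"
      have "p i = i" for i
        using p c by (metis permutes_def permutes_inj injD)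
      then show False using \<open>p \<noteq> id\<close> by auto
    qed
    then obtain i where i: "i < n" "i \<noteq> k" "p i \<noteq> i" by auto
    then have "A $$ (i, p i) = 0"
      using rows[of i "p i"] permutes_in_image[OF p, of i] by (simp add: delta_def)
    then show ?thesis using i by (auto intro!: prod_zero)
  qed
  then have "(\<Sum>p | p permutes {0..<n}. ?t p) = (\<Sum>p \<in> {id}. ?t p)"
    by (intro sum.mono_neutral_right) (auto simp: finite_permutations permutes_id)
  also have "\<dots> = (\<Prod>i = 0..<n. if i = k then A $$ (k, k) else 1)"
    using rows by (auto simp del: prod.delta intro!: prod.cong)
  also have "\<dots> = A $$ (k, k)" using k by simp
  finally show ?thesis using A by (simp add: det_def)
qed

text \<open>Every Leibniz product contains a zero: a permutation fixing all \<open>i < k\<close>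
  sends \<open>k\<close> to some \<open>j \<ge> k\<close>, and any other one moves a row
  \<open>i < k\<close> off the diagonal. The elimination below finds its nonzero entries this
  way.\<close>

lemma det_eq_0_rows_delta:
  assumes A: "A \<in> carrier_mat n n" and k: "k < n"
    and rows: "\<And>i j. i < k \<Longrightarrow> j < n \<Longrightarrow> A $$ (i, j) = delta i j"
    and zero: "\<And>j. k \<le> j \<Longrightarrow> j < n \<Longrightarrow> A $$ (k, j) = 0"
  shows "det A = 0"
proof -
  have "(\<Prod>i = 0..<n. A $$ (i, p i)) = 0" if p: "p permutes {0..<n}" for p
  proof -
    have pn: "p i < n" if "i < n" for i
      using permutes_in_image[OF p, of i] that by simp
    have "\<exists>i<n. A $$ (i, p i) = 0"
    proof (cases "\<forall>i<k. p i = i")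
      case True
      have "k \<le> p k"
      proof (rule ccontr)
        assume "\<not> k \<le> p k"
        then have "p (p k) = p k" using True by simp
        then show False using \<open>\<not> k \<le> p k\<close> p by (metis permutes_inj injD order_refl)
      qed
      then show ?thesis using zero pn k by blast
    next
      case False
      then show ?thesis using rows pn k by (metis delta_simps(2) less_trans)
    qed
    then show ?thesis by (auto intro!: prod_zero)
  qed
  then show ?thesis using A by (auto simp: det_def intro!: sum.neutral)
qed

lemma det_transvec_row:
  assumes "k < n" "f k = 0"
  shows "det (transvec n (delta k) f) = 1"
  using assms by (subst det_rows_delta[of _ n k]) simp_all

lemma det_transvec_col:
  assumes "k < n" "u k = 0"
  shows "det (transvec n u (delta k)) = 1"
proof -
  have "transpose_mat (transvec n u (delta k)) = transvec n (delta k) u"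
    by (rule eq_matI) (simp_all add: delta_def)
  then show ?thesis
    using assms det_transvec_row[of k n u] det_transpose[of "transvec n u (delta k)" n] by auto
qed

lemma carrier_SL: "carrier (SL n) = {A :: 'a::field mat. A \<in> carrier_mat n n \<and> det A = 1}"
  by (auto simp: SL_def carrier_GL)

lemma transvec_SL:
  "k < n \<Longrightarrow> f k = 0 \<Longrightarrow> transvec n (delta k) f \<in> carrier (SL n)"
  "k < n \<Longrightarrow> u k = 0 \<Longrightarrow> transvec n u (delta k) \<in> carrier (SL n)"
  by (simp_all add: carrier_SL det_transvec_row det_transvec_col)

lemma SL_GL: "A \<in> carrier (SL n) \<Longrightarrow> A \<in> carrier (GL n)"
  by (simp add: SL_def)

text \<open>Gaussian elimination by column operations: right multiplication by
  \<open>transvec n (delta k) f\<close> adds multiples of column \<open>k\<close> to the other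
  columns. Each pivot but the last becomes 1 with the help of a later column; the last is 1 because
  the determinant is.\<close>

lemma SL_le_elementary:
  fixes H :: "'a::field mat set"
  assumes H: "subgroup H (GL n)"
    and elem: "\<And>i j a. i < n \<Longrightarrow> j < n \<Longrightarrow> i \<noteq> j \<Longrightarrow> transvec n (delta i) (\<lambda>q. a * delta j q) \<in> H"
  shows "carrier (SL n) \<subseteq> H"
proof -
  interpret GL: group "GL n :: 'a mat monoid" by (rule group_GL)
  interpret H: subgroup H "GL n" by (rule H)
  have one: "1\<^sub>m n \<in> H" using H.one_closed by (simp add: one_GL)
  have row: "transvec n (delta k) f \<in> H" if k: "k < n" and f: "f k = 0" for k and f :: "nat \<Rightarrow> 'a"
  proof -
    \<comment> \<open>Induction on the number \<open>m\<close> of coordinates of \<open>f\<close>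
      that are kept; coordinate \<open>k\<close> adds nothing since \<open>f k = 0\<close>.\<close>
    have "transvec n (delta k) (\<lambda>q. if q < m then f q else 0) \<in> H" if "m \<le> n" for m
      using that
    proof (induction m)
      case 0
      then show ?case using one by (simp add: transvec_zero)
    next
      case (Suc m)
      let ?g = "\<lambda>q. if q < m then f q else 0"
      have eq: "(\<lambda>q. if q < Suc m then f q else 0) = (\<lambda>q. ?g q + f m * delta m q)"
        by (auto simp: fun_eq_iff delta_def less_Suc_eq)
      have IH: "transvec n (delta k) ?g \<in> H" using Suc by simp
      show ?case
      proof (cases "m = k")
        case True
        then show ?thesis using IH f unfolding eq by simp
      next
        case False
        have "transvec n (delta k) ?g * transvec n (delta k) (\<lambda>q. f m * delta m q) \<in> H"
          using H.m_closed[OF IH elem[of k m "f m"]] k Suc.prems False by (simp add: mult_GL)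
        then show ?thesis
          unfolding eq using k f by (subst (asm) transvec_mult) simp_all
      qed
    qed
    from this[of n] have "transvec n (delta k) (\<lambda>q. if q < n then f q else 0) \<in> H" by simp
    also have "transvec n (delta k) (\<lambda>q. if q < n then f q else 0) = transvec n (delta k) f"
      by (rule eq_matI) simp_all
    finally show ?thesis .
  qed
  have cancel: "A \<in> H"
    if "A \<in> carrier (SL n)" "k < n" "f k = 0" "A * transvec n (delta k) f \<in> H" for A k f
  proof -
    have "A \<otimes>\<^bsub>GL n\<^esub> transvec n (delta k) f \<otimes>\<^bsub>GL n\<^esub> inv\<^bsub>GL n\<^esub> transvec n (delta k) f \<in> H"
      using H.m_closed[OF that(4) H.m_inv_closed[OF row[of k f, OF that(2,3)]]] by (simp add: mult_GL)
    then show ?thesis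
      using that(1) H.mem_carrier[OF row[of k f, OF that(2,3)]] by (simp add: GL.m_assoc SL_GL)
  qed
  have op: "A * transvec n (delta k) f \<in> carrier (SL n)"
    "\<And>p q. p < n \<Longrightarrow> q < n \<Longrightarrow> (A * transvec n (delta k) f) $$ (p, q) = A $$ (p, q) + A $$ (p, k) * f q"
    if "A \<in> carrier (SL n)" "k < n" "f k = 0" for A k and f :: "nat \<Rightarrow> 'a"
  proof -
    have "A \<in> carrier_mat n n" "det A = 1" using that by (simp_all add: carrier_SL)
    then show "A * transvec n (delta k) f \<in> carrier (SL n)"
      "\<And>p q. p < n \<Longrightarrow> q < n \<Longrightarrow> (A * transvec n (delta k) f) $$ (p, q) = A $$ (p, q) + A $$ (p, k) * f q"
      using that by (simp_all add: carrier_SL mult_transvec_index det_mult[of _ n] det_transvec_row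
        mult_carrier_mat[of _ n n _ n] del: index_mult_mat(1))
  qed
  \<comment> \<open>Downward induction from \<open>k = n\<close> on the number of leading rows that
    agree with the identity.\<close>
  have "A \<in> H" if "A \<in> carrier (SL n)" "k \<le> n"
    "\<And>i j. i < k \<Longrightarrow> j < n \<Longrightarrow> A $$ (i, j) = delta i j" for A k
    using that(2,1,3)
  proof (induction k arbitrary: A rule: inc_induct)
    case base
    then have "A = 1\<^sub>m n" by (intro eq_matI) (auto simp: carrier_SL delta_def)
    then show ?case using one by simp
  next
    case (step k)
    \<comment> \<open>A pivot 1 clears the rest of row \<open>k\<close>. The rows above stay
      unchanged because column \<open>k\<close> vanishes there.\<close>
    have unit: "A \<in> H" if A: "A \<in> carrier (SL n)"
      and rows: "\<And>i j. i < k \<Longrightarrow> j < n \<Longrightarrow> A $$ (i, j) = delta i j" and 1: "A $$ (k, k) = 1" for A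
    proof (rule cancel[of A k "\<lambda>q. if q = k then 0 else - A $$ (k, q)"])
      show "A * transvec n (delta k) (\<lambda>q. if q = k then 0 else - A $$ (k, q)) \<in> H"
        using A rows 1 step.hyps
        by (intro step.IH op(1)) (auto simp: op(2) less_Suc_eq delta_def)
    qed (use A step.hyps in simp_all)
    \<comment> \<open>A nonzero entry to the right of the diagonal is used to turn the diagonal
      entry into 1.\<close>
    have pivot: "A \<in> H" if A: "A \<in> carrier (SL n)"
      and rows: "\<And>i j. i < k \<Longrightarrow> j < n \<Longrightarrow> A $$ (i, j) = delta i j"
      and r: "k < r" "r < n" "A $$ (k, r) \<noteq> 0" for A r
    proof (rule cancel[of A r "\<lambda>q. (1 - A $$ (k, k)) / A $$ (k, r) * delta k q"])
      show "A * transvec n (delta r) (\<lambda>q. (1 - A $$ (k, k)) / A $$ (k, r) * delta k q) \<in> H"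
        using A rows r step.hyps
        by (intro unit op(1)) (auto simp: op(2))
    qed (use A r in simp_all)
    have "det A \<noteq> 0" using step.prems(1) by (simp add: carrier_SL)
    then obtain r where r: "k \<le> r" "r < n" "A $$ (k, r) \<noteq> 0"
      using det_eq_0_rows_delta[of A n k] step.prems step.hyps by (auto simp: carrier_SL)
    consider "k < r" | "r = k" "Suc k < n" | "Suc k = n" "r = k"
      using r step.hyps by linarith
    then show ?case
    proof cases
      case 1
      then show ?thesis using pivot step.prems r by blast
    next
      case 2
      show ?thesis
      proof (cases "A $$ (k, Suc k) = 0")
        case True
        \<comment> \<open>Only the diagonal entry is known to be nonzero, so column \<open>k\<close>
          is first added to its right neighbour.\<close>
        show ?thesis
        proof (rule cancel[of A k "delta (Suc k)"])
          show "A * transvec n (delta k) (delta (Suc k)) \<in> H"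
            using step.prems step.hyps r 2 True
            by (intro pivot[of _ "Suc k"] op(1)) (auto simp: op(2))
        qed (use step in simp_all)
      next
        case False
        then show ?thesis using pivot[of A "Suc k"] step.prems 2 by blast
      qed
    next
      case 3
      have "det A = A $$ (k, k)"
        using step.prems 3 by (intro det_rows_delta[of _ n]) (auto simp: carrier_SL)
      then show ?thesis using unit step.prems by (simp add: carrier_SL)
    qed
  qed
  from this[of _ 0] show ?thesis by auto
qed

subsection \<open>Subgroups normalized by the special linear group\<close>

text \<open>Products are rearranged by \<open>x a y b = x (a y inv a) (a b)\<close>, which only asks
  that \<open>A\<close> normalize \<open>N\<close>.\<close>

lemma (in group) subgroup_set_mult_normalized:
  assumes N: "subgroup N G" and A: "subgroup A G"
    and norm: "\<And>a x. a \<in> A \<Longrightarrow> x \<in> N \<Longrightarrow> a \<otimes> x \<otimes> inv a \<in> N"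
  shows "subgroup (N <#> A) G"
proof -
  interpret N: subgroup N G by (rule N)
  interpret A: subgroup A G by (rule A)
  show ?thesis
  proof (rule subgroupI)
    show "N <#> A \<subseteq> carrier G"
      by (auto simp: set_mult_def)
    show "N <#> A \<noteq> {}"
      using N.one_closed A.one_closed unfolding set_mult_def by blast
  next
    fix g assume "g \<in> N <#> A"
    then obtain x a where g: "x \<in> N" "a \<in> A" "g = x \<otimes> a"
      by (auto simp: set_mult_def)
    \<comment> \<open>The double inverse puts the first factor into the shape of \<open>norm\<close>
      for \<open>inv a\<close>.\<close>
    then have "inv g = (inv a \<otimes> inv x \<otimes> inv (inv a)) \<otimes> inv a"
      by (simp add: inv_mult_group m_assoc)
    then show "inv g \<in> N <#> A"
      using g norm[of "inv a" "inv x"] unfolding set_mult_def by blast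
  next
    fix g h assume "g \<in> N <#> A" "h \<in> N <#> A"
    then obtain x a y b where g: "x \<in> N" "a \<in> A" "g = x \<otimes> a" and h: "y \<in> N" "b \<in> A" "h = y \<otimes> b"
      by (auto simp: set_mult_def)
    then have "g \<otimes> h = (x \<otimes> (a \<otimes> y \<otimes> inv a)) \<otimes> (a \<otimes> b)"
      by (simp add: m_assoc inv_solve_left)
    moreover have "x \<otimes> (a \<otimes> y \<otimes> inv a) \<in> N" "a \<otimes> b \<in> A"
      using g h norm by auto
    ultimately show "g \<otimes> h \<in> N <#> A"
      unfolding set_mult_def by blast
  qed
qed

text \<open>Once the \<open>N\<close>-parts are moved to the left, \<open>s \<otimes> t\<close> and
  \<open>t \<otimes> s\<close> differ only by elements of \<open>N\<close>, because their
  \<open>A\<close>-parts commute.\<close>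

lemma (in group) commutator_in_normalized:
  assumes N: "subgroup N G" and A: "A \<subseteq> carrier G"
    and norm: "\<And>a x. a \<in> A \<Longrightarrow> x \<in> N \<Longrightarrow> a \<otimes> x \<otimes> inv a \<in> N"
    and comm: "\<And>a b. a \<in> A \<Longrightarrow> b \<in> A \<Longrightarrow> a \<otimes> b = b \<otimes> a"
    and "s \<in> N <#> A" "t \<in> N <#> A" and c: "c \<in> carrier G" "s \<otimes> t = c \<otimes> (t \<otimes> s)"
  shows "c \<in> N"
proof -
  interpret N: subgroup N G by (rule N)
  have push: "\<exists>z \<in> N. (x \<otimes> a) \<otimes> (y \<otimes> b) = z \<otimes> (a \<otimes> b)"
    if "x \<in> N" "a \<in> A" "y \<in> N" "b \<in> A" for x a y b
  proof
    have ab: "a \<in> carrier G" "b \<in> carrier G" using that A by auto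
    show "(x \<otimes> a) \<otimes> (y \<otimes> b) = (x \<otimes> (a \<otimes> y \<otimes> inv a)) \<otimes> (a \<otimes> b)"
      using that ab by (simp add: m_assoc inv_solve_left)
    show "x \<otimes> (a \<otimes> y \<otimes> inv a) \<in> N" using that norm by auto
  qed
  obtain x a y b where s: "x \<in> N" "a \<in> A" "s = x \<otimes> a" and t: "y \<in> N" "b \<in> A" "t = y \<otimes> b"
    using assms(5,6) by (auto simp: set_mult_def)
  obtain z w where z: "z \<in> N" "s \<otimes> t = z \<otimes> (a \<otimes> b)" and w: "w \<in> N" "t \<otimes> s = w \<otimes> (a \<otimes> b)"
    using push[of x a y b] push[of y b x a] s t comm by metis
  have ab: "a \<otimes> b \<in> carrier G" using s t A by auto
  have "(c \<otimes> w) \<otimes> (a \<otimes> b) = z \<otimes> (a \<otimes> b)"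
    using z w c ab by (simp add: m_assoc)
  then have "c \<otimes> w = z" using ab z w c by simp
  then have "c = z \<otimes> inv w" using z w c by (auto simp: inv_solve_right)
  then show ?thesis using z w by simp
qed

lemma centre_GL: "centre (GL n) = {A \<in> carrier (GL n). \<exists>c::'a::field. A = c \<cdot>\<^sub>m 1\<^sub>m n}"
proof (intro equalityI subsetI)
  fix z :: "'a mat" assume z: "z \<in> centre (GL n)"
  have zc: "z \<in> carrier_mat n n" using centre_memD(1)[OF z] by (simp add: carrier_GL)
  have *: "z $$ (i, i) = z $$ (j, j) \<and> z $$ (j, i) = 0" if "i < n" "j < n" "i \<noteq> j" for i j
  proof -
    let ?T = "transvec n (delta i) (delta j) :: 'a mat"
    have "z * ?T = ?T * z"
      using centre_memD(2)[OF z, of ?T] that by (simp add: mult_GL SL_GL transvec_SL)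
    \<comment> \<open>Entry \<open>(i, j)\<close> equates two diagonal entries of \<open>z\<close>;
      entry \<open>(i, i)\<close> gives \<open>z $$ (j, i) = 0\<close>.\<close>
    then have "(z * ?T) $$ (i, j) = (?T * z) $$ (i, j)" "(z * ?T) $$ (i, i) = (?T * z) $$ (i, i)"
      by simp_all
    then show ?thesis
      using that zc by (simp add: transvec_mult_index mult_transvec_index del: index_mult_mat(1))
  qed
  have "z = z $$ (0, 0) \<cdot>\<^sub>m 1\<^sub>m n"
  proof (rule eq_matI)
    fix i j assume "i < dim_row (z $$ (0, 0) \<cdot>\<^sub>m 1\<^sub>m n)" "j < dim_col (z $$ (0, 0) \<cdot>\<^sub>m 1\<^sub>m n)"
    then show "z $$ (i, j) = (z $$ (0, 0) \<cdot>\<^sub>m 1\<^sub>m n) $$ (i, j)"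
      using *[of j i] *[of 0 i] by (cases "i = 0") auto
  qed (use zc in auto)
  then show "z \<in> {A \<in> carrier (GL n). \<exists>c. A = c \<cdot>\<^sub>m 1\<^sub>m n}"
    using centre_memD(1)[OF z] by auto
next
  fix z :: "'a mat" assume "z \<in> {A \<in> carrier (GL n). \<exists>c. A = c \<cdot>\<^sub>m 1\<^sub>m n}"
  then obtain c where c: "c \<cdot>\<^sub>m 1\<^sub>m n \<in> carrier (GL n)" "z = c \<cdot>\<^sub>m 1\<^sub>m n" by auto
  show "z \<in> centre (GL n)"
  proof (rule centre_memI)
    fix g :: "'a mat" assume "g \<in> carrier (GL n)"
    then have g: "g \<in> carrier_mat n n" by (simp add: carrier_GL)
    show "z \<otimes>\<^bsub>GL n\<^esub> g = g \<otimes>\<^bsub>GL n\<^esub> z"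
      using g by (simp add: mult_GL c mult_smult_distrib[OF g one_carrier_mat] mult_smult_assoc_mat[OF one_carrier_mat g])
  qed (use c in simp)
qed

lemma inv_transvec:
  assumes "transvec n u f \<in> carrier (SL n)" "(\<Sum>r = 0..<n. f r * u r) = 0"
  shows "inv\<^bsub>GL n\<^esub> (transvec n u f) = transvec n (\<lambda>i. - u i) f"
proof -
  interpret GL: group "GL n :: 'a mat monoid" by (rule group_GL)
  have 1: "transvec n u f * transvec n (\<lambda>i. - u i) f = 1\<^sub>m n"
    using assms(2) by (rule transvec_minus)
  then have "det (transvec n u f) * det (transvec n (\<lambda>i. - u i) f) = 1"
    by (simp flip: det_mult[of _ n])
  then have "transvec n (\<lambda>i. - u i) f \<in> carrier (GL n)" by (auto simp: carrier_GL)
  moreover note SL_GL[OF assms(1)]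
  ultimately show ?thesis
    using GL.inv_comm[of "transvec n u f"] 1 by (intro GL.inv_equality) (simp_all add: mult_GL one_GL)
qed

lemma subgroup_row_transvecs:
  assumes k: "k < n"
  shows "subgroup {transvec n (delta k) f |f. f k = (0::'a::field)} (GL n)"
proof -
  interpret GL: group "GL n :: 'a mat monoid" by (rule group_GL)
  let ?A = "{transvec n (delta k) f |f. f k = (0::'a)}"
  show ?thesis
  proof (rule GL.subgroupI)
    show "?A \<subseteq> carrier (GL n)" using k by (auto intro: SL_GL transvec_SL)
    show "?A \<noteq> {}" by auto
  next
    fix a assume "a \<in> ?A"
    then obtain f where f: "a = transvec n (delta k) f" "f k = 0" by auto
    then have "inv\<^bsub>GL n\<^esub> a = transvec n (delta k) (\<lambda>i. - f i)"
      using k by (subst f, subst inv_transvec) (auto simp: transvec_SL intro!: eq_matI)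
    then show "inv\<^bsub>GL n\<^esub> a \<in> ?A" using f by auto
  next
    fix a b assume "a \<in> ?A" "b \<in> ?A"
    then obtain f g where f: "a = transvec n (delta k) f" "f k = 0"
      and g: "b = transvec n (delta k) g" "g k = 0" by auto
    then have "a \<otimes>\<^bsub>GL n\<^esub> b = transvec n (delta k) (\<lambda>i. f i + g i)"
      using k by (simp add: mult_GL transvec_mult)
    then show "a \<otimes>\<^bsub>GL n\<^esub> b \<in> ?A" using f g by auto
  qed
qed

text \<open>A normal subgroup of any group between \<open>SL n\<close> and \<open>GL n\<close> has
  this property, so that \<open>SL\<close>, \<open>GL\<close> and the pseudocentre of
  \<open>GL\<close> can be treated together.\<close>

definition SL_normalized :: "nat \<Rightarrow> 'a::field mat set \<Rightarrow> bool" where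
  "SL_normalized n N \<longleftrightarrow> subgroup N (GL n) \<and>
    (\<forall>s \<in> carrier (SL n). \<forall>x \<in> N. s \<otimes>\<^bsub>GL n\<^esub> x \<otimes>\<^bsub>GL n\<^esub> inv\<^bsub>GL n\<^esub> s \<in> N)"

lemma SL_normalizedD:
  assumes "SL_normalized n N"
  shows "subgroup N (GL n)"
    and "s \<in> carrier (SL n) \<Longrightarrow> x \<in> N \<Longrightarrow> s \<otimes>\<^bsub>GL n\<^esub> x \<otimes>\<^bsub>GL n\<^esub> inv\<^bsub>GL n\<^esub> s \<in> N"
  using assms unfolding SL_normalized_def by auto

lemma SL_normalized_carrier: "SL_normalized n N \<Longrightarrow> x \<in> N \<Longrightarrow> x \<in> carrier_mat n n"
  using subgroup.mem_carrier[OF SL_normalizedD(1)] by (fastforce simp: carrier_GL)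

lemma conj_transvec:
  assumes N: "SL_normalized n N" and x: "x \<in> N"
    and T: "transvec n u f \<in> carrier (SL n)" "(\<Sum>r = 0..<n. f r * u r) = 0"
  shows "transvec n u f * x * transvec n (\<lambda>i. - u i) f \<in> N"
  using SL_normalizedD(2)[OF N T(1) x] by (simp add: inv_transvec[OF T] mult_GL)

lemma conj_transvec_index:
  assumes x: "x \<in> carrier_mat n n" and pq: "p < n" "q < n"
  shows "(transvec n u f * x * transvec n (\<lambda>i. - u i) f) $$ (p, q) =
    (transvec n u f * x) $$ (p, q) - (\<Sum>r = 0..<n. (transvec n u f * x) $$ (p, r) * u r) * f q"
proof -
  have "transvec n u f * x \<in> carrier_mat n n"
    using x by (simp add: mult_carrier_mat[of _ n n _ n])
  from mult_transvec_index[OF this pq] show ?thesis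
    by (simp add: sum_negf)
qed

text \<open>A diagonal matrix that is not scalar has two distinct diagonal entries, and conjugation
  by an elementary matrix puts their difference off the diagonal. The conclusion says that
  \<open>e\<^sub>k\<close> is not an eigenvector of \<open>y\<close>.\<close>

lemma noncentral_offdiag:
  assumes N: "SL_normalized n N" and x: "x \<in> N" "x \<notin> centre (GL n)"
  obtains y l k where "y \<in> N" "l < n" "k < n" "l \<noteq> k" "y $$ (l, k) \<noteq> 0"
proof (cases "\<exists>l k. l < n \<and> k < n \<and> l \<noteq> k \<and> x $$ (l, k) \<noteq> 0")
  case True
  then show ?thesis using that x by blast
next
  case False
  note xc = SL_normalized_carrier[OF N x(1)]
  have "\<exists>i j. i < n \<and> j < n \<and> x $$ (i, i) \<noteq> x $$ (j, j)"
  proof (rule ccontr)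
    assume c: "\<not> ?thesis"
    have "x = x $$ (0, 0) \<cdot>\<^sub>m 1\<^sub>m n"
    proof (rule eq_matI)
      fix i j assume "i < dim_row (x $$ (0, 0) \<cdot>\<^sub>m 1\<^sub>m n)" "j < dim_col (x $$ (0, 0) \<cdot>\<^sub>m 1\<^sub>m n)"
      then have ij: "i < n" "j < n" "0 < n" by auto
      have "x $$ (i, i) = x $$ (0, 0)" "i \<noteq> j \<Longrightarrow> x $$ (i, j) = 0"
        using False c ij by blast+
      then show "x $$ (i, j) = (x $$ (0, 0) \<cdot>\<^sub>m 1\<^sub>m n) $$ (i, j)"
        using ij by (cases "i = j") auto
    qed (use xc in auto)
    moreover have "x \<in> carrier (GL n)"
      using subgroup.mem_carrier[OF SL_normalizedD(1)[OF N] x(1)] .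
    ultimately show False using x(2) unfolding centre_GL by blast
  qed
  then obtain i j where ij: "i < n" "j < n" "x $$ (i, i) \<noteq> x $$ (j, j)" by blast
  then have "i \<noteq> j" by auto
  let ?y = "transvec n (delta i) (delta j) * x * transvec n (\<lambda>r. - delta i r) (delta j)"
  have "?y \<in> N"
    using ij \<open>i \<noteq> j\<close> by (intro conj_transvec[OF N x(1)]) (simp_all add: transvec_SL)
  moreover have "x $$ (i, j) = 0" "x $$ (j, i) = 0"
    using False ij \<open>i \<noteq> j\<close> by blast+
  then have "?y $$ (i, j) = x $$ (j, j) - x $$ (i, i)"
    using ij xc
    by (simp add: conj_transvec_index transvec_mult_index del: index_mult_mat(1))
  ultimately show ?thesis using that ij \<open>i \<noteq> j\<close> by auto
qed

text \<open>Both conjugations used here fix \<open>e\<^sub>k\<close>, so they only act on the \<open>k\<close>-th column of the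
  conjugated element: the first makes its \<open>i\<close>-th entry nonzero, the second clears all others.\<close>

lemma move_basis_line:
  assumes N: "SL_normalized n N" and x: "x \<in> N" "x $$ (l, k) \<noteq> 0"
    and lk: "l < n" "k < n" "l \<noteq> k" and i: "i < n" "i \<noteq> k"
  obtains m where "m \<in> N" "m $$ (i, k) \<noteq> 0" "\<And>p. p < n \<Longrightarrow> p \<noteq> i \<Longrightarrow> m $$ (p, k) = 0"
proof -
  obtain y where y: "y \<in> N" "y $$ (i, k) \<noteq> 0"
  proof (cases "x $$ (i, k) = 0")
    case True
    then have "i \<noteq> l" using x by auto
    let ?y = "transvec n (delta i) (delta l) * x * transvec n (\<lambda>r. - delta i r) (delta l)"
    have "?y \<in> N"
      using lk i \<open>i \<noteq> l\<close> by (intro conj_transvec[OF N x(1)]) (simp_all add: transvec_SL)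
    moreover have "?y $$ (i, k) = x $$ (l, k)"
      using True lk i SL_normalized_carrier[OF N x(1)]
      by (simp add: conj_transvec_index transvec_mult_index del: index_mult_mat(1))
    ultimately show ?thesis using that x by auto
  qed (use that x in blast)
  note yc = SL_normalized_carrier[OF N y(1)]
  let ?u = "\<lambda>p. if p = i then 0 else - y $$ (p, k) / y $$ (i, k)"
  let ?m = "transvec n ?u (delta i) * y * transvec n (\<lambda>r. - ?u r) (delta i)"
  have "?m \<in> N"
    using i by (intro conj_transvec[OF N y(1)]) (simp_all add: transvec_SL)
  moreover have "?m $$ (p, k) = y $$ (p, k) + ?u p * y $$ (i, k)" if "p < n" for p
    using that lk i yc by (simp add: conj_transvec_index transvec_mult_index del: index_mult_mat(1))
  ultimately show ?thesis using that[of ?m] y i by simp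
qed

text \<open>For \<open>i \<noteq> k\<close> let \<open>m\<close> in \<open>N\<close> satisfy
  \<open>m e\<^sub>k = c e\<^sub>i\<close>. Then \<open>(1 + a e\<^sub>i e\<^sub>j\<^sup>T) m = m (1
  + e\<^sub>k g\<^sup>T)\<close>, where \<open>g\<close> is \<open>a / c\<close> times row
  \<open>j\<close> of \<open>m\<close>.\<close>

lemma elementary_in_set_mult:
  fixes N :: "'a::field mat set"
  assumes N: "SL_normalized n N" and x: "x \<in> N" "x $$ (l, k) \<noteq> 0"
    and lk: "l < n" "k < n" "l \<noteq> k" and ij: "i < n" "j < n" "i \<noteq> j"
  shows "transvec n (delta i) (\<lambda>q. a * delta j q)
    \<in> N <#>\<^bsub>GL n\<^esub> {transvec n (delta k) f |f. f k = (0::'a)}"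
proof -
  interpret GL: group "GL n :: 'a mat monoid" by (rule group_GL)
  interpret N: subgroup N "GL n" using SL_normalizedD(1)[OF N] .
  let ?R = "transvec n (delta i) (\<lambda>q. a * delta j q)"
  have one: "1\<^sub>m n \<in> N" using N.one_closed by (simp add: one_GL)
  show ?thesis
  proof (cases "i = k")
    case True
    have "?R = 1\<^sub>m n \<otimes>\<^bsub>GL n\<^esub> ?R" by (simp add: mult_GL left_mult_one_mat[of _ n n])
    moreover have "a * delta j k = 0" using True ij by auto
    ultimately show ?thesis using one True unfolding set_mult_def by blast
  next
    case False
    obtain m where m: "m \<in> N" "m $$ (i, k) \<noteq> 0" "\<And>p. p < n \<Longrightarrow> p \<noteq> i \<Longrightarrow> m $$ (p, k) = 0"
      using move_basis_line[OF N x lk ij(1) False] by blast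
    note mc = SL_normalized_carrier[OF N m(1)]
    let ?g = "\<lambda>q. a / m $$ (i, k) * m $$ (j, q)"
    let ?B = "transvec n (delta k) ?g"
    \<comment> \<open>Column \<open>k\<close> of \<open>m\<close> is zero outside row
      \<open>i\<close>, and \<open>j \<noteq> i\<close>.\<close>
    have gk: "?g k = 0" using m ij by simp
    have B: "?B \<in> carrier (SL n)" using transvec_SL(1)[of k n ?g] lk gk by simp
    have R: "?R \<in> carrier (GL n)" using ij by (simp add: SL_GL transvec_SL)
    have "?R * m = m * ?B"
    proof (rule eq_matI)
      fix p q assume "p < dim_row (m * ?B)" "q < dim_col (m * ?B)"
      then have pq: "p < n" "q < n" using mc by auto
      have "(\<Sum>r = 0..<n. a * delta j r * m $$ (r, q)) = a * m $$ (j, q)"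
        using ij by (simp add: mult.assoc flip: sum_distrib_left)
      then show "(?R * m) $$ (p, q) = (m * ?B) $$ (p, q)"
        using pq mc m lk ij
        by (cases "p = i") (simp_all add: transvec_mult_index mult_transvec_index del: index_mult_mat(1))
    qed (use mc in auto)
    then have "?R = m \<otimes>\<^bsub>GL n\<^esub> ?B \<otimes>\<^bsub>GL n\<^esub> inv\<^bsub>GL n\<^esub> m"
      using R SL_GL[OF B] N.mem_carrier[OF m(1)] GL.m_closed[OF N.mem_carrier[OF m(1)] SL_GL[OF B]]
      by (subst GL.inv_solve_right) (simp_all only: mult_GL GL.m_closed)
    \<comment> \<open>The factor in parentheses is \<open>m\<close> times a conjugate of its inverse
      by an element of \<open>SL\<close>, hence in \<open>N\<close>.\<close>
    then have "?R = (m \<otimes>\<^bsub>GL n\<^esub> (?B \<otimes>\<^bsub>GL n\<^esub> inv\<^bsub>GL n\<^esub> m \<otimes>\<^bsub>GL n\<^esub> inv\<^bsub>GL n\<^esub> ?B)) \<otimes>\<^bsub>GL n\<^esub> ?B"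
      using B m(1) by (simp add: SL_GL GL.m_assoc)
    moreover have "m \<otimes>\<^bsub>GL n\<^esub> (?B \<otimes>\<^bsub>GL n\<^esub> inv\<^bsub>GL n\<^esub> m \<otimes>\<^bsub>GL n\<^esub> inv\<^bsub>GL n\<^esub> ?B) \<in> N"
      using SL_normalizedD(2)[OF N B] m(1) by simp
    ultimately show ?thesis using gk unfolding set_mult_def by blast
  qed
qed

text \<open>The equation makes the elementary matrix a commutator, in the form used by
  \<open>commutator_in_normalized\<close>. If there is a third index \<open>l\<close>, elementary
  matrices at \<open>(i, l)\<close> and \<open>(l, j)\<close> serve.\<close>

lemma elementary_commutator:
  fixes a :: "'a::field"
  assumes ij: "i < n" "j < n" "i \<noteq> j" and big: "n > 2 \<or> (\<exists>d::'a. d \<noteq> 0 \<and> d\<^sup>2 \<noteq> 1)"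
  obtains s t where "s \<in> carrier (SL n)" "t \<in> carrier (SL n)"
    "s * t = transvec n (delta i) (\<lambda>q. a * delta j q) * (t * s)"
  using big
proof
  assume "n > 2"
  have "card {i, j} < card {0..<n}" using \<open>n > 2\<close> ij by simp
  then have "\<not> {0..<n} \<subseteq> {i, j}" by (meson card_mono finite.emptyI finite.insertI not_le)
  then obtain l where "l \<in> {0..<n}" "l \<notin> {i, j}" by blast
  then have l: "l < n" "l \<noteq> i" "l \<noteq> j" by auto
  let ?s = "transvec n (delta i) (\<lambda>q. a * delta l q)" and ?t = "transvec n (delta l) (delta j) :: 'a mat"
  let ?E = "transvec n (delta i) (\<lambda>q. a * delta j q)"
  have sum: "(\<Sum>r = 0..<n. a * delta k r * h r) = a * h k" if "k < n" for k h
    using that by (simp add: mult.assoc flip: sum_distrib_left)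
  have "?s * ?t = ?E * (?t * ?s)"
  proof (rule eq_matI)
    fix p q assume "p < dim_row (?E * (?t * ?s))" "q < dim_col (?E * (?t * ?s))"
    then have pq: "p < n" "q < n" by auto
    then show "(?s * ?t) $$ (p, q) = (?E * (?t * ?s)) $$ (p, q)"
      using ij l by (simp add: transvec_mult_index sum mult_carrier_mat[of _ n n _ n] del: index_mult_mat(1))
        (simp add: delta_def)
  qed auto
  then show ?thesis using that[of ?s ?t] ij l by (simp add: transvec_SL)
next
  \<comment> \<open>Conjugation by a diagonal matrix with entries \<open>d\<close> and \<open>1 / d\<close> at \<open>i\<close> and \<open>j\<close> multiplies the
    off-diagonal entry by \<open>d\<^sup>2\<close>.\<close>
  assume "\<exists>d::'a. d \<noteq> 0 \<and> d\<^sup>2 \<noteq> 1"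
  then obtain d :: 'a where d: "d \<noteq> 0" "d\<^sup>2 \<noteq> 1" by blast
  \<comment> \<open>Chosen so that \<open>a + b = d\<^sup>2 * b\<close>, which gives
    \<open>?E * ?t = ?F\<close>.\<close>
  define b where "b = a / (d\<^sup>2 - 1)"
  have ab: "a = (d\<^sup>2 - 1) * b" using d by (simp add: b_def)
  \<comment> \<open>Written with two factors so that the determinant splits into a product giving
    \<open>d\<close> and one giving \<open>1 / d\<close>.\<close>
  define c where "c p = (if p = i then d else 1) * (if p = j then 1 / d else 1)" for p
  define D where "D = mat n n (\<lambda>(p, q). delta p q * c p)"
  have Dc: "D \<in> carrier_mat n n" by (simp add: D_def)
  have "det D = (\<Prod>p = 0..<n. c p)"
    using Dc by (subst det_upper_triangular[of _ n])
      (auto simp: prod_list_diag_prod D_def upper_triangular_def delta_def)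
  also have "\<dots> = 1" using ij d by (simp add: c_def prod.distrib)
  finally have D: "D \<in> carrier (SL n)" using Dc by (simp add: carrier_SL)
  let ?t = "transvec n (delta i) (\<lambda>q. b * delta j q)"
  let ?E = "transvec n (delta i) (\<lambda>q. a * delta j q)"
  let ?F = "transvec n (delta i) (\<lambda>q. d\<^sup>2 * b * delta j q)"
  have sum: "(\<Sum>r = 0..<n. e * delta k r * h r) = e * h k" if "k < n" for e h k
    using that by (simp add: mult.assoc flip: sum_distrib_left)
  have "?E * ?t = ?F"
    using ij sum[of j a "delta i"] by (subst transvec_mult) (simp_all, simp add: ab algebra_simps)
  then have "?E * (?t * D) = ?F * D"
    using Dc by (simp flip: assoc_mult_mat[of _ n n _ n _ n])
  also have "\<dots> = D * ?t"
  proof (rule eq_matI)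
    fix p q assume "p < dim_row (D * ?t)" "q < dim_col (D * ?t)"
    then have pq: "p < n" "q < n" using Dc by auto
    then have "(?F * D) $$ (p, q) = D $$ (p, q) + delta i p * (d\<^sup>2 * b * D $$ (j, q))"
      "(D * ?t) $$ (p, q) = D $$ (p, q) + D $$ (p, i) * (b * delta j q)"
      using ij Dc by (simp_all add: transvec_mult_index mult_transvec_index sum del: index_mult_mat(1))
    moreover have "delta i p * (d\<^sup>2 * b * D $$ (j, q)) = D $$ (p, i) * (b * delta j q)"
      using pq ij d by (simp add: D_def c_def delta_def power2_eq_square)
    ultimately show "(?F * D) $$ (p, q) = (D * ?t) $$ (p, q)" by simp
  qed (use Dc in auto)
  finally show ?thesis using that[of D ?t] D ij by (simp add: transvec_SL)
qed

lemma SL_le_normalized: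
  fixes N :: "'a::field mat set"
  assumes N: "SL_normalized n N" and x: "x \<in> N" "x \<notin> centre (GL n)"
    and big: "n > 2 \<or> (\<exists>d::'a. d \<noteq> 0 \<and> d\<^sup>2 \<noteq> 1)"
  shows "carrier (SL n) \<subseteq> N"
proof -
  interpret GL: group "GL n :: 'a mat monoid" by (rule group_GL)
  obtain y l k where y: "y \<in> N" "l < n" "k < n" "l \<noteq> k" "y $$ (l, k) \<noteq> 0"
    using noncentral_offdiag[OF N x] .
  let ?A = "{transvec n (delta k) f |f. f k = (0::'a)}"
  have A: "?A \<subseteq> carrier (SL n)" using y transvec_SL(1) by auto
  have norm: "a \<otimes>\<^bsub>GL n\<^esub> x \<otimes>\<^bsub>GL n\<^esub> inv\<^bsub>GL n\<^esub> a \<in> N" if "a \<in> ?A" "x \<in> N" for a x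
    using SL_normalizedD(2)[OF N _ that(2)] that(1) A by blast
  have comm: "a \<otimes>\<^bsub>GL n\<^esub> b = b \<otimes>\<^bsub>GL n\<^esub> a" if "a \<in> ?A" "b \<in> ?A" for a b
    using that y by (auto simp: mult_GL transvec_mult add.commute)
  \<comment> \<open>Generation by elementary matrices is used twice: here for \<open>N A\<close>,
    and then for \<open>N\<close>.\<close>
  have NA: "carrier (SL n) \<subseteq> N <#>\<^bsub>GL n\<^esub> ?A"
  proof (rule SL_le_elementary)
    show "subgroup (N <#>\<^bsub>GL n\<^esub> ?A) (GL n)"
      using GL.subgroup_set_mult_normalized[OF SL_normalizedD(1)[OF N] subgroup_row_transvecs[OF y(3)] norm] .
  qed (use elementary_in_set_mult[OF N y(1,5,2-4)] in blast)
  show ?thesis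
  proof (rule SL_le_elementary[OF SL_normalizedD(1)[OF N]])
    fix i j and a :: 'a assume ij: "i < n" "j < n" "i \<noteq> j"
    let ?E = "transvec n (delta i) (\<lambda>q. a * delta j q)"
    obtain s t where st: "s \<in> carrier (SL n)" "t \<in> carrier (SL n)" "s * t = ?E * (t * s)"
      using elementary_commutator[OF ij big] .
    show "?E \<in> N"
    proof (rule GL.commutator_in_normalized[where A = ?A and s = s and t = t])
      show "subgroup N (GL n)" using SL_normalizedD(1)[OF N] .
      show "?A \<subseteq> carrier (GL n)" using A SL_GL by blast
      show "s \<in> N <#>\<^bsub>GL n\<^esub> ?A" "t \<in> N <#>\<^bsub>GL n\<^esub> ?A" using st NA by blast+
      show "?E \<in> carrier (GL n)" using ij by (simp add: SL_GL transvec_SL)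
      show "s \<otimes>\<^bsub>GL n\<^esub> t = ?E \<otimes>\<^bsub>GL n\<^esub> (t \<otimes>\<^bsub>GL n\<^esub> s)" using st by (simp add: mult_GL)
    qed (fact norm comm)+
  qed
qed

subsection \<open>The centralizer of a unipotent Jordan block\<close>

definition unipotent_block :: "nat \<Rightarrow> 'a::field mat" where
  "unipotent_block n = mat n n (\<lambda>(i, j). delta i j + delta (Suc i) j)"

lemma unipotent_block_carrier [simp]: "unipotent_block n \<in> carrier_mat n n"
  by (simp add: unipotent_block_def)

lemma det_unipotent_block: "det (unipotent_block n) = 1"
  by (subst det_upper_triangular[of _ n])
    (auto simp: prod_list_diag_prod unipotent_block_def upper_triangular_def delta_def)

lemma mult_unipotent_block_index:
  assumes g: "g \<in> carrier_mat n n" and pq: "p < n" "q < n"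
  shows "(g * unipotent_block n) $$ (p, q) = g $$ (p, q) + (if q = 0 then 0 else g $$ (p, q - 1))"
    and "(unipotent_block n * g) $$ (p, q) = g $$ (p, q) + (if Suc p < n then g $$ (Suc p, q) else 0)"
proof -
  have "(g * unipotent_block n) $$ (p, q)
      = (\<Sum>r = 0..<n. g $$ (p, r) * delta r q) + (\<Sum>r = 0..<n. g $$ (p, r) * delta (Suc r) q)"
    using g pq by (simp add: unipotent_block_def scalar_prod_def distrib_left sum.distrib)
  also have "(\<Sum>r = 0..<n. g $$ (p, r) * delta (Suc r) q) = (if q = 0 then 0 else g $$ (p, q - 1))"
  proof (cases q)
    case (Suc q')
    then have "(\<lambda>r. delta (Suc r) q) = (\<lambda>r. delta r q' :: 'a)" by (auto simp: delta_def)
    then show ?thesis using Suc pq by (simp add: fun_eq_iff)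
  qed simp
  finally show "(g * unipotent_block n) $$ (p, q) = g $$ (p, q) + (if q = 0 then 0 else g $$ (p, q - 1))"
    using pq by simp
  have "(unipotent_block n * g) $$ (p, q)
      = (\<Sum>r = 0..<n. delta p r * g $$ (r, q)) + (\<Sum>r = 0..<n. delta (Suc p) r * g $$ (r, q))"
    using g pq by (simp add: unipotent_block_def scalar_prod_def distrib_right sum.distrib)
  also have "(\<Sum>r = 0..<n. delta (Suc p) r * g $$ (r, q)) = (if Suc p < n then g $$ (Suc p, q) else 0)"
    by (auto intro!: sum.neutral)
  finally show "(unipotent_block n * g) $$ (p, q) = g $$ (p, q) + (if Suc p < n then g $$ (Suc p, q) else 0)"
    using pq by simp
qed

text \<open>The scalar \<open>c\<close> covers matrices that commute modulo the centre. Comparing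
  entries forces \<open>c = 1\<close> and then makes \<open>g\<close> upper triangular and constant
  along diagonals.\<close>

lemma det_commuting_unipotent_block:
  fixes g :: "'a::field mat"
  assumes g: "g \<in> carrier_mat n n" "det g \<noteq> 0" and n: "0 < n"
    and comm: "g * unipotent_block n = c \<cdot>\<^sub>m (unipotent_block n * g)"
  shows "det g = g $$ (0, 0) ^ n"
proof -
  have eq: "g $$ (p, q) + (if q = 0 then 0 else g $$ (p, q - 1))
      = c * (g $$ (p, q) + (if Suc p < n then g $$ (Suc p, q) else 0))" if "p < n" "q < n" for p q
  proof -
    have "(g * unipotent_block n) $$ (p, q) = (c \<cdot>\<^sub>m (unipotent_block n * g)) $$ (p, q)"
      using comm by simp
    also have "\<dots> = c * (unipotent_block n * g) $$ (p, q)"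
      using that g by (simp add: unipotent_block_def)
    finally show ?thesis using that g by (simp only: mult_unipotent_block_index)
  qed
  have "c = 1"
  proof (rule ccontr)
    assume "c \<noteq> 1"
    \<comment> \<open>The last row has no row below it, so \<open>(1 - c) * g $$ (n - 1, q)\<close>
      is minus the entry to the left, or 0 if \<open>q = 0\<close>.\<close>
    have "g $$ (n - 1, q) = 0" if "q < n" for q
      using that
    proof (induction q)
      case 0
      then show ?case using eq[of "n - 1" 0] n \<open>c \<noteq> 1\<close> by simp
    next
      case (Suc q)
      then show ?case using eq[of "n - 1" "Suc q"] n \<open>c \<noteq> 1\<close> by simp
    qed
    then have "det g = 0"
      using laplace_expansion_row[OF g(1), of "n - 1"] n by simp
    then show False using g by simp
  qed
  have shift: "g $$ (Suc p, Suc q) = g $$ (p, q)" if "Suc p < n" "Suc q < n" for p q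
    using eq[of p "Suc q"] that \<open>c = 1\<close> by simp
  \<comment> \<open>Column 0 vanishes below the diagonal by \<open>eq\<close> at
    \<open>q = 0\<close>; \<open>shift\<close> carries this to the other columns.\<close>
  have upper: "g $$ (p, q) = 0" if "q < p" "p < n" for p q
    using that
  proof (induction q arbitrary: p)
    case 0
    then show ?case using eq[of "p - 1" 0] \<open>c = 1\<close> by simp
  next
    case (Suc q)
    then show ?case using shift[of "p - 1" q] Suc.IH[of "p - 1"] by simp
  qed
  have diag: "g $$ (p, p) = g $$ (0, 0)" if "p < n" for p
    using that by (induction p) (simp_all add: shift)
  have "det g = (\<Prod>i = 0..<n. g $$ (i, i))"
    using g upper by (subst det_upper_triangular[of _ n]) (auto simp: prod_list_diag_prod upper_triangular_def)
  also have "\<dots> = (\<Prod>i = 0..<n. g $$ (0, 0))"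
    by (intro prod.cong refl diag) simp
  also have "\<dots> = g $$ (0, 0) ^ n" by simp
  finally show ?thesis .
qed

subsection \<open>Centralizers and normal subgroups\<close>

lemma pseudocentre_greatest:
  assumes "\<And>x N. x \<in> carrier G \<Longrightarrow> N \<lhd> G \<Longrightarrow> centralizer G x \<subseteq> N \<Longrightarrow> A \<subseteq> N"
  shows "A \<subseteq> pseudocentre G"
  using assms unfolding pseudocentre_def normal_closure_def by blast

lemma pseudocentre_lower:
  assumes "x \<in> carrier G" "N \<lhd> G" "centralizer G x \<subseteq> N"
  shows "pseudocentre G \<subseteq> N"
  using assms unfolding pseudocentre_def normal_closure_def by blast

lemma centralizer_central: "x \<in> centre G \<Longrightarrow> centralizer G x = carrier G"
  unfolding centre_def centralizer_def by auto

lemma centre_le_centralizer: "x \<in> carrier G \<Longrightarrow> centre G \<subseteq> centralizer G x"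
  unfolding centre_def centralizer_def by blast

lemma (in group_hom) normal_vimage:
  assumes "N \<lhd> H"
  shows "{g \<in> carrier G. h g \<in> N} \<lhd> G"
proof (rule G.normal_invI)
  interpret N: normal N H by (rule assms)
  show "subgroup {g \<in> carrier G. h g \<in> N} G"
    by (rule G.subgroupI) (auto intro!: exI[of _ "\<one>\<^bsub>G\<^esub>"])
  show "x \<otimes>\<^bsub>G\<^esub> k \<otimes>\<^bsub>G\<^esub> inv\<^bsub>G\<^esub> x \<in> {g \<in> carrier G. h g \<in> N}"
    if "x \<in> carrier G" "k \<in> {g \<in> carrier G. h g \<in> N}" for x k
    using that by (simp add: N.inv_op_closed2)
qed

lemma (in normal) group_hom_Mod: "group_hom G (G Mod H) (\<lambda>g. H #> g)"
  by (simp add: group_hom_def group_hom_axioms_def is_group factorgroup_is_group r_coset_hom_Mod)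

context
  fixes n :: nat and H :: "'a::field mat set"
  assumes big: "n > 2 \<or> (\<exists>d::'a. d \<noteq> 0 \<and> d\<^sup>2 \<noteq> 1)"
    and H: "subgroup H (GL n)" "carrier (SL n) \<subseteq> H"
begin

text \<open>A central \<open>x\<close> has all of \<open>H\<close> as its centralizer. Otherwise
  \<open>x\<close> itself, lying in its own centralizer, is a non-central element of
  \<open>N\<close>.\<close>

lemma SL_le_normal_centralizer:
  assumes N: "N \<lhd> (GL n)\<lparr>carrier := H\<rparr>" and x: "x \<in> H"
    and C: "centralizer ((GL n)\<lparr>carrier := H\<rparr>) x \<subseteq> N"
  shows "carrier (SL n) \<subseteq> N"
proof (cases "x \<in> centre (GL n)")
  case True
  then have "x \<in> centre ((GL n)\<lparr>carrier := H\<rparr>)"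
    using x subgroup.mem_carrier[OF H(1)] by (auto simp: centre_def)
  then show ?thesis using C H(2) by (simp add: centralizer_central)
next
  case False
  have "SL_normalized n N"
    unfolding SL_normalized_def
  proof (intro conjI ballI)
    show "subgroup N (GL n)"
      using group.incl_subgroup[OF group_GL H(1)] N by (simp add: normal_imp_subgroup)
    fix s y :: "'a mat" assume s: "s \<in> carrier (SL n)" and y: "y \<in> N"
    show "s \<otimes>\<^bsub>GL n\<^esub> y \<otimes>\<^bsub>GL n\<^esub> inv\<^bsub>GL n\<^esub> s \<in> N"
      using normal.inv_op_closed2[OF N _ y, of s] s H group.m_inv_consistent[OF group_GL H(1), of s]
      by auto
  qed
  moreover have "x \<in> N" using C x by (auto simp: centralizer_def)
  ultimately show ?thesis using False big by (rule SL_le_normalized)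
qed

text \<open>The preimage of \<open>N\<close> in \<open>K\<close> is normal and contains the
  centralizer of a representative of \<open>X\<close>, so the previous lemma applies to it.\<close>

lemma SL_le_normal_centralizer_Mod:
  fixes K defines "K \<equiv> (GL n)\<lparr>carrier := H\<rparr>"
  assumes Z: "Z \<lhd> K" and N: "N \<lhd> K Mod Z"
    and X: "X \<in> carrier (K Mod Z)" and C: "centralizer (K Mod Z) X \<subseteq> N"
    and s: "s \<in> carrier (SL n)"
  shows "Z #>\<^bsub>K\<^esub> s \<in> N"
proof -
  interpret Z: normal Z K by (rule Z)
  interpret q: group_hom K "K Mod Z" "\<lambda>g. Z #>\<^bsub>K\<^esub> g" by (rule Z.group_hom_Mod)
  obtain x where x: "x \<in> carrier K" "X = Z #>\<^bsub>K\<^esub> x"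
    using X by (auto simp: carrier_FactGroup)
  let ?M = "{g \<in> carrier K. Z #>\<^bsub>K\<^esub> g \<in> N}"
  have "centralizer K x \<subseteq> ?M"
  proof
    fix g assume "g \<in> centralizer K x"
    then have g: "g \<in> carrier K" "g \<otimes>\<^bsub>K\<^esub> x = x \<otimes>\<^bsub>K\<^esub> g" by (auto simp: centralizer_def)
    then have "Z #>\<^bsub>K\<^esub> g \<in> centralizer (K Mod Z) X"
      using x q.hom_mult[of g x] q.hom_mult[of x g] q.hom_closed[of g] by (simp add: centralizer_def)
    then show "g \<in> ?M" using g C by auto
  qed
  then have "carrier (SL n) \<subseteq> ?M"
    using q.normal_vimage[OF N] x unfolding K_def by (intro SL_le_normal_centralizer) auto
  then show ?thesis using s by auto
qed

end

section \<open>Scalar matrices and determinants that are \<open>n\<close>-th powers\<close>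

lemma scalar_in_centre:
  assumes "c \<noteq> (0::'a::field)"
  shows "c \<cdot>\<^sub>m 1\<^sub>m n \<in> centre (GL n)"
  using assms by (auto simp: centre_GL carrier_GL)

text \<open>A scalar \<open>c\<close> contributes \<open>c ^ n\<close> to the determinant;
  conversely, dividing by \<open>c\<close> brings \<open>A\<close> into \<open>SL\<close>.\<close>

lemma SL_centre_product:
  assumes "0 < n"
  shows "centre (GL n) <#>\<^bsub>GL n\<^esub> carrier (SL n) = {A \<in> carrier (GL n). \<exists>c::'a::field. det A = c ^ n}" (is "_ = ?D")
    and "carrier (SL n) <#>\<^bsub>GL n\<^esub> centre (GL n) = {A \<in> carrier (GL n). \<exists>c::'a::field. det A = c ^ n}"
proof -
  interpret GL: group "GL n :: 'a mat monoid" by (rule group_GL)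
  show "centre (GL n) <#>\<^bsub>GL n\<^esub> carrier (SL n) = ?D"
  proof (intro equalityI subsetI)
    fix A assume "A \<in> centre (GL n) <#>\<^bsub>GL n\<^esub> carrier (SL n :: 'a mat monoid)"
    then obtain z s where zs: "z \<in> centre (GL n)" "s \<in> carrier (SL n)" "A = z * s"
      by (auto simp: set_mult_def mult_GL)
    then obtain c where c: "z = c \<cdot>\<^sub>m 1\<^sub>m n" by (auto simp: centre_GL)
    have "det A = c ^ n"
      using zs c by (simp add: carrier_SL det_mult[of _ n])
    moreover have "A \<in> carrier (GL n)"
      using GL.m_closed[OF centre_memD(1)[OF zs(1)] SL_GL[OF zs(2)]] zs(3) by (simp add: mult_GL)
    ultimately show "A \<in> ?D" by auto
  next
    fix A :: "'a mat" assume "A \<in> ?D"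
    then obtain c where A: "A \<in> carrier_mat n n" "det A = c ^ n" "det A \<noteq> 0" by (auto simp: carrier_GL)
    \<comment> \<open>For \<open>n > 0\<close>, \<open>c = 0\<close> would give
      \<open>det A = 0\<close>.\<close>
    then have "c \<noteq> 0" using assms by auto
    let ?s = "inverse c \<cdot>\<^sub>m A"
    have "?s \<in> carrier (SL n)"
      using A \<open>c \<noteq> 0\<close> by (auto simp: carrier_SL power_inverse)
    moreover have "A = (c \<cdot>\<^sub>m 1\<^sub>m n) \<otimes>\<^bsub>GL n\<^esub> ?s"
      using A \<open>c \<noteq> 0\<close>
      by (auto simp: mult_GL mult_smult_assoc_mat[of _ n n _ n])
    ultimately show "A \<in> centre (GL n) <#>\<^bsub>GL n\<^esub> carrier (SL n)"
      using scalar_in_centre[OF \<open>c \<noteq> 0\<close>, of n] unfolding set_mult_def by blast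
  qed
  moreover have "carrier (SL n) <#>\<^bsub>GL n\<^esub> centre (GL n) = centre (GL n) <#>\<^bsub>GL n\<^esub> carrier (SL n :: 'a mat monoid)"
    using GL.commut_normal[OF subgroup_SL GL.centre_normal] .
  ultimately show "carrier (SL n) <#>\<^bsub>GL n\<^esub> centre (GL n) = ?D" by simp
qed

text \<open>This is the preimage under \<open>det\<close> of the subgroup of \<open>n\<close>-th
  powers in an abelian group.\<close>

lemma nth_power_det_normal: "{A \<in> carrier (GL n). \<exists>c::'a::field. det A = c ^ n} \<lhd> GL n" (is "?D \<lhd> _")
proof -
  interpret GL: group "GL n :: 'a mat monoid" by (rule group_GL)
  have mult: "det (A \<otimes>\<^bsub>GL n\<^esub> B) = det A * det B" if "A \<in> carrier (GL n)" "B \<in> carrier (GL n)" for A B :: "'a mat"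
    using that by (simp add: mult_GL carrier_GL det_mult[of _ n])
  have det_inv: "det (inv\<^bsub>GL n\<^esub> A) = inverse (det A)" if "A \<in> carrier (GL n)" for A :: "'a mat"
    using mult[of A "inv\<^bsub>GL n\<^esub> A"] that by (simp add: one_GL inverse_unique)
  have nz: "det A \<noteq> 0" if "A \<in> carrier (GL n)" for A :: "'a mat"
    using that by (simp add: carrier_GL)
  show ?thesis
  proof (rule GL.normal_invI)
    show "subgroup ?D (GL n)"
    proof (rule GL.subgroupI)
      have "det (\<one>\<^bsub>GL n\<^esub> :: 'a mat) = 1 ^ n" by (simp add: one_GL)
      then show "?D \<noteq> {}" using GL.one_closed by blast
    next
      fix A assume "A \<in> ?D"
      then obtain c where "A \<in> carrier (GL n)" "det A = c ^ n" by auto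
      then show "inv\<^bsub>GL n\<^esub> A \<in> ?D"
        by (auto simp: det_inv intro!: exI[of _ "inverse c"] simp flip: power_inverse)
    next
      fix A B assume "A \<in> ?D" "B \<in> ?D"
      then obtain c d where "A \<in> carrier (GL n)" "det A = c ^ n" "B \<in> carrier (GL n)" "det B = d ^ n" by auto
      then show "A \<otimes>\<^bsub>GL n\<^esub> B \<in> ?D"
        by (auto simp: mult intro!: exI[of _ "c * d"] power_mult_distrib[symmetric])
    qed auto
    show "x \<otimes>\<^bsub>GL n\<^esub> h \<otimes>\<^bsub>GL n\<^esub> inv\<^bsub>GL n\<^esub> x \<in> ?D" if "x \<in> carrier (GL n)" "h \<in> ?D" for x h
      using that nz[of x] by (auto simp: mult det_inv field_simps)
  qed
qed

section \<open>The five pseudocentres\<close>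

theorem theorem7p2:
  fixes n :: nat
    and G S :: "'a::field mat monoid"
  assumes "(n = 2 \<and> (infinite (UNIV :: 'a set) \<or> card (UNIV :: 'a set) > 3)) \<or> n > 2"
    and "G = GL n"
    and "S = SL n"
  shows "(pseudocentre G = centre G <#>\<^bsub>G\<^esub> carrier S
      \<and> centre G <#>\<^bsub>G\<^esub> carrier S = {A \<in> carrier G. \<exists>c::'a. det A = c ^ n})
      \<and> pseudocentre S = carrier S
      \<and> pseudocentre (S Mod centre S) = carrier (S Mod centre S)
      \<and> pseudocentre (G Mod centre G) =
          carrier (G\<lparr>carrier := carrier S <#>\<^bsub>G\<^esub> centre G\<rparr> Mod centre G)
      \<and> pseudocentre (G\<lparr>carrier := pseudocentre G\<rparr>) = pseudocentre G"
proof -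
  have n: "0 < n" using assms(1) by auto
  have big: "n > 2 \<or> (\<exists>d::'a. d \<noteq> 0 \<and> d\<^sup>2 \<noteq> 1)"
  proof (cases "n > 2")
    case False
    \<comment> \<open>In a field \<open>d\<^sup>2 = 1\<close> forces \<open>d = 1\<close> or
      \<open>d = -1\<close>, so any element outside this set serves.\<close>
    have "(UNIV :: 'a set) \<noteq> {0, 1, -1}"
    proof
      assume U: "(UNIV :: 'a set) = {0, 1, -1}"
      then have "finite (UNIV :: 'a set)" by (metis finite.emptyI finite.insertI)
      moreover have "card (UNIV :: 'a set) \<le> 3"
        unfolding U by (rule card_insert_le_m1 | simp)+
      ultimately show False using assms(1) False by auto
    qed
    then show ?thesis by (auto simp: power2_eq_1_iff)
  qed simp
  interpret G: group G unfolding assms(2) by (rule group_GL)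
  interpret S: group S unfolding assms(3) by (rule group_SL)
  interpret Z: normal "centre G" G by (rule G.centre_normal)
  interpret ZS: normal "centre S" S by (rule S.centre_normal)
  \<comment> \<open>Both groups are put into the form
    \<open>(GL n)\<lparr>carrier := H\<rparr>\<close> of the lemmas on normal subgroups.\<close>
  have G_eq: "G = (GL n)\<lparr>carrier := carrier (GL n)\<rparr>" and S_eq: "S = (GL n)\<lparr>carrier := carrier (SL n)\<rparr>"
    using assms(2,3) by (simp_all add: SL_def)
  have "carrier (SL n :: 'a mat monoid) \<subseteq> carrier (GL n)" by (auto simp: SL_GL)
  note whole = big group.subgroup_self[OF group_GL] this
  note special = big subgroup_SL order.refl
  define D where "D = {A \<in> carrier G. \<exists>c::'a. det A = c ^ n}"
  have D: "centre G <#>\<^bsub>G\<^esub> carrier S = D" "carrier S <#>\<^bsub>G\<^esub> centre G = D"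
    using SL_centre_product[OF n] by (simp_all add: D_def assms(2,3))
  have D_normal: "D \<lhd> G"
    using nth_power_det_normal by (simp add: D_def assms(2))
  have SD: "carrier S \<subseteq> D"
    by (auto simp: D_def assms(2,3) SL_GL) (auto simp: carrier_SL intro: exI[of _ 1])
  have ZD: "centre G \<subseteq> D"
  proof
    fix z assume z: "z \<in> centre G"
    have "z \<otimes>\<^bsub>G\<^esub> \<one>\<^bsub>G\<^esub> \<in> centre G <#>\<^bsub>G\<^esub> carrier S"
      using z subgroup.one_closed[OF subgroup_SL] unfolding set_mult_def assms(2,3) by blast
    then show "z \<in> D" using centre_memD(1)[OF z] by (simp add: D)
  qed
  let ?J = "unipotent_block n :: 'a mat"
  have J: "?J \<in> carrier G"
    by (simp add: assms(2) carrier_GL det_unipotent_block)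
  \<comment> \<open>The case \<open>c = 1\<close> bounds the pseudocentre of \<open>G\<close>;
    general \<open>c\<close> is for \<open>G Mod centre G\<close>, where commuting means commuting
    up to a scalar.\<close>
  have commJ: "g \<in> D" if "g \<in> carrier G" "g * ?J = c \<cdot>\<^sub>m (?J * g)" for g c
    using det_commuting_unipotent_block[OF _ _ n that(2)] that(1) by (auto simp: D_def assms(2) carrier_GL)
  have 1: "pseudocentre G = D"
  proof
    show "pseudocentre G \<subseteq> D"
    proof (rule pseudocentre_lower[OF J D_normal])
      have "1 \<cdot>\<^sub>m A = A" for A :: "'a mat" by (rule eq_matI) auto
      then show "centralizer G ?J \<subseteq> D"
        using commJ[of _ 1] by (auto simp: centralizer_def assms(2) mult_GL)
    qed
    show "D \<subseteq> pseudocentre G"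
    proof (rule pseudocentre_greatest)
      fix x N assume x: "x \<in> carrier G" and N: "N \<lhd> G" and C: "centralizer G x \<subseteq> N"
      have "carrier S \<subseteq> N"
        using SL_le_normal_centralizer[OF whole, of N x] x N C assms(2,3) by simp
      moreover have "centre G \<subseteq> N"
        using C centre_le_centralizer[OF x] by blast
      ultimately show "D \<subseteq> N"
        using subgroup.m_closed[OF normal_imp_subgroup[OF N]] unfolding D(1)[symmetric] set_mult_def by blast
    qed
  qed
  have 2: "pseudocentre S = carrier S"
  proof
    show "pseudocentre S \<subseteq> carrier S"
      using subgroup.subset[OF normal_imp_subgroup[OF S.pseudocentre_normal]] .
    show "carrier S \<subseteq> pseudocentre S"
      using SL_le_normal_centralizer[OF special] unfolding S_eq[symmetric]
      by (intro pseudocentre_greatest) (simp add: assms(3))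
  qed
  have 3: "pseudocentre (S Mod centre S) = carrier (S Mod centre S)"
  proof
    show "pseudocentre (S Mod centre S) \<subseteq> carrier (S Mod centre S)"
      using subgroup.subset[OF normal_imp_subgroup[OF group.pseudocentre_normal[OF ZS.factorgroup_is_group]]] .
    show "carrier (S Mod centre S) \<subseteq> pseudocentre (S Mod centre S)"
    proof (rule pseudocentre_greatest)
      fix X N assume "X \<in> carrier (S Mod centre S)" "N \<lhd> S Mod centre S" "centralizer (S Mod centre S) X \<subseteq> N"
      then have "centre S #>\<^bsub>S\<^esub> s \<in> N" if "s \<in> carrier S" for s
        using SL_le_normal_centralizer_Mod[OF special, folded S_eq, OF S.centre_normal] that
        by (simp add: assms(3))
      then show "carrier (S Mod centre S) \<subseteq> N" by (auto simp: carrier_FactGroup)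
    qed
  qed
  interpret q: group_hom G "G Mod centre G" "\<lambda>g. centre G #>\<^bsub>G\<^esub> g" by (rule Z.group_hom_Mod)
  let ?q = "\<lambda>g. centre G #>\<^bsub>G\<^esub> g"
  have 4: "pseudocentre (G Mod centre G) = ?q ` D"
  proof
    show "pseudocentre (G Mod centre G) \<subseteq> ?q ` D"
    proof (rule pseudocentre_lower)
      show "?q ?J \<in> carrier (G Mod centre G)" using q.hom_closed[OF J] .
      show "?q ` D \<lhd> G Mod centre G"
        by (rule normal.surj_hom_normal_subgroup[OF D_normal q.group_hom_axioms]) (simp add: carrier_FactGroup)
      show "centralizer (G Mod centre G) (?q ?J) \<subseteq> ?q ` D"
      proof
        fix Y assume "Y \<in> centralizer (G Mod centre G) (?q ?J)"
        then have Y: "Y \<in> ?q ` carrier G" "Y <#>\<^bsub>G\<^esub> ?q ?J = ?q ?J <#>\<^bsub>G\<^esub> Y"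
          by (simp_all add: centralizer_def carrier_FactGroup)
        then obtain g where g: "g \<in> carrier G" "Y = ?q g" by blast
        have "?q g <#>\<^bsub>G\<^esub> ?q ?J = ?q ?J <#>\<^bsub>G\<^esub> ?q g"
          using Y(2) unfolding g(2) .
        then have "?q (g \<otimes>\<^bsub>G\<^esub> ?J) = ?q (?J \<otimes>\<^bsub>G\<^esub> g)"
          unfolding Z.rcos_sum[OF g(1) J] Z.rcos_sum[OF J g(1)] .
        then have "g \<otimes>\<^bsub>G\<^esub> ?J \<in> ?q (?J \<otimes>\<^bsub>G\<^esub> g)"
          using G.rcos_self[OF G.m_closed[OF g(1) J] Z.subgroup_axioms] by metis
        then obtain z where z: "z \<in> centre G" "g \<otimes>\<^bsub>G\<^esub> ?J = z \<otimes>\<^bsub>G\<^esub> (?J \<otimes>\<^bsub>G\<^esub> g)"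
          by (auto simp: r_coset_def)
        then obtain c where "z = c \<cdot>\<^sub>m 1\<^sub>m n" by (auto simp: assms(2) centre_GL)
        moreover have "?J * g \<in> carrier_mat n n"
          using g(1) by (simp add: assms(2) carrier_GL mult_carrier_mat[of _ n n _ n])
        ultimately have "g * ?J = c \<cdot>\<^sub>m (?J * g)"
          using z(2) by (simp add: assms(2) mult_GL mult_smult_assoc_mat[of _ n n _ n] left_mult_one_mat)
        then show "Y \<in> ?q ` D" using commJ g by blast
      qed
    qed
    show "?q ` D \<subseteq> pseudocentre (G Mod centre G)"
    proof (rule pseudocentre_greatest)
      fix X N assume X: "X \<in> carrier (G Mod centre G)" and N: "N \<lhd> G Mod centre G"
        and C: "centralizer (G Mod centre G) X \<subseteq> N"
      have "?q s \<in> N" if "s \<in> carrier S" for s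
        using SL_le_normal_centralizer_Mod[OF whole, folded G_eq, OF G.centre_normal N X C] that
        by (simp add: assms(3))
      \<comment> \<open>Cosets absorb central factors, so the image of \<open>D\<close> is already
        the image of \<open>SL\<close>.\<close>
      moreover have "?q (z \<otimes>\<^bsub>G\<^esub> s) = ?q s" if "z \<in> centre G" "s \<in> carrier G" for z s
        using that by (metis G.coset_mult_assoc Z.rcos_const Z.subset G.is_group subsetD)
      moreover have "carrier S \<subseteq> carrier G" by (auto simp: assms(2,3) SL_GL)
      ultimately show "?q ` D \<subseteq> N"
        unfolding D(1)[symmetric] set_mult_def by auto
    qed
  qed
  have 5: "pseudocentre (G\<lparr>carrier := D\<rparr>) = D"
  proof
    have sub: "subgroup D G" using normal_imp_subgroup[OF D_normal] .
    interpret GD: group "G\<lparr>carrier := D\<rparr>" using G.subgroup_imp_group[OF sub] .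
    show "pseudocentre (G\<lparr>carrier := D\<rparr>) \<subseteq> D"
      using subgroup.subset[OF normal_imp_subgroup[OF GD.pseudocentre_normal]] by simp
    show "D \<subseteq> pseudocentre (G\<lparr>carrier := D\<rparr>)"
    proof (rule pseudocentre_greatest)
      fix x N assume x: "x \<in> carrier (G\<lparr>carrier := D\<rparr>)" and N: "N \<lhd> G\<lparr>carrier := D\<rparr>"
        and C: "centralizer (G\<lparr>carrier := D\<rparr>) x \<subseteq> N"
      have "carrier S \<subseteq> N"
        using SL_le_normal_centralizer[OF big, of D N x] sub SD x N C assms(2,3) by simp
      \<comment> \<open>Central elements of \<open>G\<close> lie in \<open>D\<close> and commute
        with \<open>x\<close>, so they belong to its centralizer inside \<open>D\<close>.\<close>
      moreover have "centre G \<subseteq> N"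
        using C x ZD centre_le_centralizer[of x G] subgroup.mem_carrier[OF sub, of x]
        unfolding centralizer_def by auto
      ultimately show "D \<subseteq> N"
        using subgroup.m_closed[OF normal_imp_subgroup[OF N]] unfolding D(1)[symmetric] set_mult_def by fastforce
    qed
  qed
  \<comment> \<open>Cosets depend only on the multiplication, which is unchanged when the carrier is
    restricted.\<close>
  show ?thesis
    using 1 2 3 4 5 D by (simp add: D_def carrier_FactGroup r_coset_def)
qed

end
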